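(* For every integer $k\geq 2$ and all integers $d_1,\dots,d_k\geq 3$, writing $\mathbf{d}=(d_1,\dots,d_k)$, we have $$\operatorname{rk}_{\mathbf{d}}(W_{d_1}\otimes\cdots\otimes W_{d_k})\leq 2^{k-1}\left(d_1+\cdots+d_k-2k+2\right).$$
   Context: All vector spaces are over $\mathbb{C}$. Let $e_1,e_2$ be a basis of $\mathbb{C}^2$. For a positive integer $d$, the (generalized) $W$-state is the symmetric tensor $$W_d=\sum_{i=1}^d e_1^{\otimes (i-1)}\otimes e_2\otimes e_1^{\otimes(d-i)}\in \operatorname{Sym}^d\mathbb{C}^2\subset(\mathbb{C}^2)^{\otimes d},$$ which up to a nonzero scalar corresponds to the binary form $x^{d-1}y$. Thus $W_{d_1}\otimes\cdots\otimes W_{d_k}\in \operatorname{Sym}^{d_1}\mathbb{C}^2\otimes\cdots\otimes\operatorname{Sym}^{d_k}\mathbb{C}^2$ (each factor having its own copy of $\mathbb{C}^2$). For $T\in \operatorname{Sym}^{d_1}\mathbb{C}^{2}\otimes\cdots\otimes\operatorname{Sym}^{d_k}\mathbb{C}^{2}$, the partially symmetric rank $\operatorname{rk}_{\mathbf{d}}(T)$ is the minimum integer $r$ such that $T=\sum_{i=1}^r (v_i^{(1)})^{\otimes d_1}\otimes\cdots\otimes (v_i^{(k)})^{\otimes d_k}$ for some vectors $v_i^{(j)}\in\mathbb{C}^2$. *)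

theory Defs
  imports "HOL-Analysis.Analysis" "HOL-Library.Extended_Nat"
begin

text \<open>
  Tensors are represented by their coordinate arrays: an element of a space with coordinates
  indexed by \<open>'i\<close> is a function \<open>'i \<Rightarrow> complex\<close>, and a \<open>k\<close>-fold tensor product of such spaces
  is indexed by lists of length \<open>k\<close> over \<open>'i\<close> (arrays vanish on lists of any other length).
  So \<open>(\<complex>\<^sup>2)\<^sup>\<otimes>\<^sup>d\<close> consists of functions on lists of length \<open>d\<close> over the two-element type \<open>2\<close>,
  and the product of several such spaces, with orders \<open>d\<^sub>1, \<dots>, d\<^sub>k\<close>, of functions on lists of
  \<open>k\<close> such lists, the \<open>j\<close>-th one having length \<open>d\<^sub>j\<close>.  The same product is used at both levels.
\<close>

definition tensor_prod :: "('i \<Rightarrow> complex) list \<Rightarrow> 'i list \<Rightarrow> complex" where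
  "tensor_prod ts is =
     (if length is = length ts then \<Prod>j<length ts. (ts ! j) (is ! j) else 0)"

definition elem_tensor :: "(complex ^ 2) list \<Rightarrow> 2 list \<Rightarrow> complex" where
  "elem_tensor vs = tensor_prod (map vec_nth vs)"

definition tensor_power :: "nat \<Rightarrow> complex ^ 2 \<Rightarrow> 2 list \<Rightarrow> complex" where
  "tensor_power d v = elem_tensor (replicate d v)"

definition is_basis2 :: "complex ^ 2 \<Rightarrow> complex ^ 2 \<Rightarrow> bool" where
  "is_basis2 e1 e2 \<longleftrightarrow>
     e1 \<noteq> e2 \<and> vec.independent {e1, e2} \<and> vec.span {e1, e2} = UNIV"

definition W_state :: "complex ^ 2 \<Rightarrow> complex ^ 2 \<Rightarrow> nat \<Rightarrow> 2 list \<Rightarrow> complex" where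
  "W_state e1 e2 d =
     (\<lambda>idx. \<Sum>i=1..d. elem_tensor (replicate (i - 1) e1 @ [e2] @ replicate (d - i) e1) idx)"

definition has_ps_decomp :: "nat list \<Rightarrow> (2 list list \<Rightarrow> complex) \<Rightarrow> nat \<Rightarrow> bool" where
  "has_ps_decomp ds T r \<longleftrightarrow>
     (\<exists>v :: nat \<Rightarrow> nat \<Rightarrow> complex ^ 2.
        T = (\<lambda>idx. \<Sum>i<r. tensor_prod
               (map (\<lambda>j. tensor_power (ds ! j) (v i j)) [0..<length ds]) idx))"

text \<open>
  The minimum is taken in \<open>enat\<close>, so that an array without any decomposition (one that is not
  partially symmetric) has rank \<open>\<infinity>\<close>.
\<close>

definition ps_rank :: "nat list \<Rightarrow> (2 list list \<Rightarrow> complex) \<Rightarrow> enat" where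
  "ps_rank ds T = (INF r \<in> {r. has_ps_decomp ds T r}. enat r)"

end

theory Submission
  imports Defs "HOL-Computational_Algebra.Polynomial"
begin

text \<open>
  The entries of \<open>(e\<^sub>1 + z e\<^sub>2)\<^sup>\<otimes>\<^sup>d\<close> are polynomials in \<open>z\<close> of degree at most \<open>d\<close>, and the
  entries of \<open>W\<^sub>d\<close> are their coefficients of \<open>z\<close> (\<open>W_state_entry\<close>).  A decomposition of
  \<open>W\<^sub>d\<^sub>1 \<otimes> \<dots> \<otimes> W\<^sub>d\<^sub>k\<close> with \<open>r\<close> terms is therefore obtained from any quadrature formula with \<open>r\<close>
  nodes that reads off the coefficient of \<open>z\<^sub>1 \<cdots> z\<^sub>k\<close> from the values of a polynomial of degree at
  most \<open>d\<^sub>j\<close> in each \<open>z\<^sub>j\<close>; the complex weights are absorbed into the vectors by taking roots.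

  The nodes lie on the \<open>2\<^sup>k\<^sup>-\<^sup>1\<close> lines \<open>s \<mapsto> (s, \<plusminus>s, \<dots>, \<plusminus>s)\<close>, with \<open>N = d\<^sub>1 + \<dots> + d\<^sub>k - 2k + 2\<close> nodes on
  each.  A line is given by the set \<open>E\<close> of coordinates with a minus sign, and its nodes have
  \<open>s\<^sup>N = \<lambda>\<^sub>E\<close> for a sign \<open>\<lambda>\<^sub>E\<close> chosen below.  On a monomial with exponents \<open>a\<^sub>j \<le> d\<^sub>j\<close> and total
  degree \<open>S\<close>, averaging \<open>s\<^sup>-\<^sup>k\<close> times the values over one line gives zero unless
  \<open>S \<equiv> k (mod N)\<close>.  Since \<open>k < N\<close>, only \<open>S = k\<close> and \<open>S = k + N\<close> remain, and the latter comes
  with the factor \<open>\<lambda>\<^sub>E\<close>.  Then the lines are summed with signs \<open>(-1)\<^bsup>|E|\<^esup>\<close>: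

  \<^item> If \<open>S = k\<close>, only monomials with \<open>a\<^sub>2, \<dots>, a\<^sub>k\<close> all odd survive.  These exponents have sum
    at least \<open>k - 1\<close>, of the same parity as \<open>k - 1\<close>, so that \<open>S = k\<close> makes every exponent one.

  \<^item> If \<open>S = k + N\<close>, the choice \<open>\<lambda>\<^sub>E = \<Prod>\<^sub>j\<^sub>\<in>\<^sub>E (-1)\<^bsup>d\<^sub>j\<^esup>\<close> leaves only monomials for which
    \<open>d\<^sub>j - a\<^sub>j\<close> is odd, hence positive, for all \<open>j \<ge> 2\<close>.  But these differences have sum at most
    \<open>d\<^sub>1 + \<dots> + d\<^sub>k - S = k - 2\<close>, which is too small for \<open>k - 1\<close> positive integers.

  The inequality \<open>k < N\<close> holds because the bounds \<open>d\<^sub>j \<ge> 3\<close> give \<open>N \<ge> k + 2\<close>.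
\<close>

section \<open>Sums over roots and over signs\<close>

lemma sum_powers_of_nth_roots:
  fixes c :: complex
  assumes "N > 0" "c \<noteq> 0"
  shows "(\<Sum>s | s ^ N = c. s ^ m) = (if N dvd m then of_nat N * c ^ (m div N) else 0)"
proof (cases "N dvd m")
  case True
  then obtain q where q: "m = N * q" by blast
  have "(\<Sum>s | s ^ N = c. s ^ m) = (\<Sum>s | s ^ N = c. c ^ q)"
    by (intro sum.cong) (auto simp: q power_mult)
  also have "\<dots> = of_nat N * c ^ q"
    using card_nth_roots[OF assms(2,1)] by simp
  finally show ?thesis using assms q by simp
next
  case False
  \<comment> \<open>Multiplication by a primitive \<open>N\<close>-th root of unity permutes the roots of \<open>s ^ N = c\<close> and
    multiplies the sum by \<open>u ^ m \<noteq> 1\<close>.\<close>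
  define u where "u = exp (2 * of_real pi * \<i> * of_nat 1 / of_nat N)"
  have uN: "u ^ N = 1"
    using complex_root_unity[of N 1] assms by (simp add: u_def)
  have u0: "u \<noteq> 0" by (simp add: u_def)
  have um: "u ^ m \<noteq> 1"
  proof
    assume "u ^ m = 1"
    then have "exp (2 * of_real pi * \<i> * of_nat m / of_nat N) = 1"
      by (simp add: u_def exp_of_nat_mult[symmetric] mult_ac)
    then show False
      using complex_root_unity_eq_1[of N m] assms False by simp
  qed
  have "bij_betw (\<lambda>s. u * s) {s. s ^ N = c} {s. s ^ N = c}"
    by (rule bij_betw_byWitness[where f' = "\<lambda>s. s / u"])
       (auto simp: u0 uN power_mult_distrib power_divide)
  then have "(\<Sum>s | s ^ N = c. s ^ m) = (\<Sum>s | s ^ N = c. (u * s) ^ m)"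
    by (rule sum.reindex_bij_betw[symmetric])
  also have "\<dots> = u ^ m * (\<Sum>s | s ^ N = c. s ^ m)"
    by (simp add: power_mult_distrib sum_distrib_left)
  finally show ?thesis using um False by simp
qed

text \<open>The sum over all subsets is the expansion of \<open>\<Prod>\<^sub>j\<^sub>\<in>\<^sub>A (1 + (-1)\<^bsup>b j\<^esup>)\<close>.\<close>

lemma sum_Pow_prod_signs:
  fixes b :: "nat \<Rightarrow> nat"
  assumes "finite A"
  shows "(\<Sum>E\<in>Pow A. \<Prod>j\<in>E. (- 1 :: complex) ^ b j)
           = (if \<forall>j\<in>A. even (b j) then 2 ^ card A else 0)"
proof -
  have "(\<Sum>E\<in>Pow A. \<Prod>j\<in>E. (- 1 :: complex) ^ b j) = (\<Prod>j\<in>A. (- 1) ^ b j + 1)"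
    using prod_add[OF assms, of "\<lambda>j. (- 1 :: complex) ^ b j" "\<lambda>_. 1"] by simp
  also have "\<dots> = (if \<forall>j\<in>A. even (b j) then 2 ^ card A else 0)"
    using assms by (auto simp: prod_zero_iff intro: bexI[rotated])
  finally show ?thesis .
qed

section \<open>A quadrature formula for the multilinear coefficient\<close>

text \<open>
  The sign \<open>\<lambda>\<^sub>E\<close> whose \<open>N\<close>-th roots are the parameters of the nodes on the line \<open>E\<close>.  A character
  of the group of sign changes is used so that the sum over \<open>E\<close> factorises, and the exponents
  \<open>d j\<close> are those that eliminate the total degree \<open>k + N\<close>.
\<close>

definition line_sign :: "(nat \<Rightarrow> nat) \<Rightarrow> nat set \<Rightarrow> complex" where
  "line_sign d E = (\<Prod>j\<in>E. (- 1) ^ d j)"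

text \<open>
  A node \<open>(E, s)\<close> stands for the point with coordinates \<open>-s\<close> at the indices in \<open>E\<close> and \<open>s\<close>
  elsewhere.  Complementary sets of indices give the same line, and the sets without \<open>0\<close>
  represent each line once.
\<close>

definition nodes :: "nat \<Rightarrow> (nat \<Rightarrow> nat) \<Rightarrow> nat \<Rightarrow> (nat set \<times> complex) set" where
  "nodes k d N = (SIGMA E:Pow {1..<k}. {s. s ^ N = line_sign d E})"

definition node_coord :: "nat set \<times> complex \<Rightarrow> nat \<Rightarrow> complex" where
  "node_coord x j = (if j \<in> fst x then - snd x else snd x)"

definition node_weight :: "nat \<Rightarrow> nat \<Rightarrow> nat set \<times> complex \<Rightarrow> complex" where
  "node_weight k N x = (- 1) ^ card (fst x) / (2 ^ (k - 1) * of_nat N * snd x ^ k)"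

lemma line_sign_square: "line_sign d E * line_sign d E = 1"
  by (simp add: line_sign_def flip: prod.distrib power_add)

lemma line_sign_nonzero: "line_sign d E \<noteq> 0"
  using line_sign_square[of d E] by auto

lemma finite_nodes: "N > 0 \<Longrightarrow> finite (nodes k d N)"
  unfolding nodes_def by (intro finite_SigmaI finite_nth_roots) auto

lemma card_nodes:
  assumes "N > 0"
  shows "card (nodes k d N) = 2 ^ (k - 1) * N"
proof -
  have "card (nodes k d N) = (\<Sum>E\<in>Pow {1..<k}. card {s. s ^ N = line_sign d E})"
    unfolding nodes_def using assms by (intro card_SigmaI ballI finite_nth_roots) auto
  also have "\<dots> = 2 ^ (k - 1) * N"
    using assms by (simp add: card_nth_roots line_sign_nonzero card_Pow)
  finally show ?thesis .
qed

text \<open>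
  This is the heart of the proof: the roots of unity select the total degree, and the signs
  select the monomial \<open>z\<^sub>0 \<cdots> z\<^sub>k\<^sub>-\<^sub>1\<close> within the two total degrees that remain.
\<close>

lemma quadrature_monomial:
  fixes a d :: "nat \<Rightarrow> nat"
  assumes "k > 0"
    and N: "(\<Sum>j<k. d j) + 2 = N + 2 * k" and "N > k"
    and ad: "\<And>j. j < k \<Longrightarrow> a j \<le> d j"
  shows "(\<Sum>x\<in>nodes k d N. node_weight k N x * (\<Prod>j<k. node_coord x j ^ a j))
           = (if \<forall>j<k. a j = 1 then 1 else 0)"
proof -
  define S where "S = (\<Sum>j<k. a j)"
  have split0: "(\<Sum>j<k. f j) = f 0 + (\<Sum>j=1..<k. f j)" for f :: "nat \<Rightarrow> nat"
    using \<open>k > 0\<close> by (simp add: lessThan_atLeast0 sum.atLeast_Suc_lessThan)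
  have S_le: "S \<le> N + 2 * k - 2"
    using sum_mono[of "{..<k}" a d] ad N by (simp add: S_def)
  have powers: "(\<Prod>j<k. node_coord (E, s) j ^ a j) = (\<Prod>j\<in>E. (- 1) ^ a j) * s ^ S"
    if "E \<in> Pow {1..<k}" for E s
  proof -
    have "node_coord (E, s) j ^ a j = (if j \<in> E then (- 1) ^ a j else 1) * s ^ a j" for j
      by (simp add: node_coord_def power_minus[of s])
    then have "(\<Prod>j<k. node_coord (E, s) j ^ a j)
        = (\<Prod>j<k. if j \<in> E then (- 1) ^ a j else 1) * s ^ S"
      by (simp add: prod.distrib S_def power_sum)
    also have "(\<Prod>j<k. if j \<in> E then (- 1) ^ a j else (1::complex))
        = (\<Prod>j\<in>E. (- 1) ^ a j)"
      using that by (subst prod.inter_restrict[symmetric]) (auto intro!: prod.cong)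
    finally show ?thesis .
  qed
  have inner: "(\<Sum>s | s ^ N = line_sign d E. s ^ S / s ^ k)
      = of_nat N * (if S = k then 1 else if S = k + N then line_sign d E else 0)" for E
  proof -
    \<comment> \<open>As \<open>s ^ N\<close> is a sign, the negative power of \<open>s\<close> can be traded for \<open>s ^ (N - k)\<close>.\<close>
    have "s ^ S / s ^ k = line_sign d E * s ^ (S + N - k)" if "s ^ N = line_sign d E" for s
    proof -
      have "s \<noteq> 0"
        using that line_sign_nonzero[of d E] \<open>N > k\<close> by (auto simp: power_0_left)
      have "s ^ (S + N - k) * s ^ k = s ^ S * line_sign d E"
        using \<open>N > k\<close> by (simp flip: power_add that)
      then have "line_sign d E * s ^ (S + N - k) * s ^ k = s ^ S * (line_sign d E * line_sign d E)"
        by (simp add: mult_ac)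
      then show ?thesis
        using \<open>s \<noteq> 0\<close> by (simp add: line_sign_square field_simps)
    qed
    then have "(\<Sum>s | s ^ N = line_sign d E. s ^ S / s ^ k)
        = line_sign d E * (\<Sum>s | s ^ N = line_sign d E. s ^ (S + N - k))"
      by (simp add: sum_distrib_left)
    also have "\<dots> = line_sign d E * (if N dvd S + N - k
        then of_nat N * line_sign d E ^ ((S + N - k) div N) else 0)"
      using \<open>N > k\<close> by (subst sum_powers_of_nth_roots) (auto simp: line_sign_nonzero)
    also have "\<dots> = of_nat N * (if S = k then 1 else if S = k + N then line_sign d E else 0)"
    proof (cases "N dvd S + N - k")
      case True
      then obtain q where q: "S + N - k = N * q" by blast
      \<comment> \<open>The exponent lies strictly between \<open>0\<close> and \<open>3 N\<close>, both bounds by \<open>k < N\<close>.\<close>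
      have "0 < N * q" "N * q < N * 3"
        using q S_le \<open>N > k\<close> by linarith+
      then have "q = 1 \<or> q = 2" by auto
      then show ?thesis
      proof
        assume "q = 1"
        then have "S = k" using q \<open>N > k\<close> by simp
        then show ?thesis using \<open>N > k\<close> by (simp add: line_sign_square mult_ac)
      next
        assume "q = 2"
        then have "S = k + N" using q \<open>N > k\<close> by simp
        moreover have "(k + N + N - k) div N = 2" using \<open>N > k\<close> by simp
        ultimately show ?thesis
          using \<open>N > k\<close> q \<open>q = 2\<close> by (simp add: power2_eq_square mult_ac line_sign_square)
      qed
    next
      case False
      moreover have "S \<noteq> k" using False by auto
      moreover have "S \<noteq> k + N" using False by auto
      ultimately show ?thesis by simp
    qed
    finally show ?thesis .
  qed
  have "(\<Sum>x\<in>nodes k d N. node_weight k N x * (\<Prod>j<k. node_coord x j ^ a j))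
      = (\<Sum>E\<in>Pow {1..<k}. \<Sum>s | s ^ N = line_sign d E.
           node_weight k N (E, s) * (\<Prod>j<k. node_coord (E, s) j ^ a j))"
    unfolding nodes_def using \<open>N > k\<close>
    by (subst sum.Sigma) (auto intro!: finite_nth_roots)
  also have "\<dots> = (\<Sum>E\<in>Pow {1..<k}. (- 1) ^ card E / (2 ^ (k - 1) * of_nat N)
      * (\<Prod>j\<in>E. (- 1) ^ a j) * (\<Sum>s | s ^ N = line_sign d E. s ^ S / s ^ k))"
    by (intro sum.cong refl)
       (simp add: powers node_weight_def sum_distrib_left sum_divide_distrib mult_ac)
  also have "\<dots> = (\<Sum>E\<in>Pow {1..<k}. (\<Prod>j\<in>E. (- 1) ^ (a j + 1))
      * (if S = k then 1 else if S = k + N then line_sign d E else 0)) / 2 ^ (k - 1)"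
    using \<open>N > k\<close> unfolding inner sum_divide_distrib
    by (intro sum.cong refl) (simp add: prod_uminus)
  also have "\<dots> = (if \<forall>j<k. a j = 1 then 1 else 0)"
  proof (cases "S = k")
    case True
    have "(\<forall>j\<in>{1..<k}. even (a j + 1)) \<longleftrightarrow> (\<forall>j<k. a j = 1)"
    proof
      assume odd: "\<forall>j\<in>{1..<k}. even (a j + 1)"
      \<comment> \<open>Writing the odd exponents as \<open>1 + 2 b j\<close>, total degree \<open>k\<close> leaves
        \<open>a 0 + 2 \<Sum> b j = 1\<close>.\<close>
      define b where "b j = a j div 2" for j
      have a: "a j = 1 + 2 * b j" if "j \<in> {1..<k}" for j
        using odd that by (simp add: b_def odd_two_times_div_two_succ)
      then have "(\<Sum>j=1..<k. a j) = (\<Sum>j=1..<k. 1 + 2 * b j)"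
        by (intro sum.cong) auto
      also have "\<dots> = (k - 1) + 2 * (\<Sum>j=1..<k. b j)"
        by (simp only: sum.distrib) (simp add: sum_distrib_left)
      finally have "a 0 + 2 * (\<Sum>j=1..<k. b j) = 1"
        using True \<open>k > 0\<close> split0[of a] by (simp add: S_def)
      then have a0: "a 0 = 1" and "(\<Sum>j=1..<k. b j) = 0"
        by presburger+
      then have "b j = 0" if "j \<in> {1..<k}" for j using that by simp
      then show "\<forall>j<k. a j = 1"
        using a a0 by (metis One_nat_def Suc_leI add.right_neutral atLeastLessThan_iff gr0I mult_0_right)
    next
      assume "\<forall>j<k. a j = 1"
      then show "\<forall>j\<in>{1..<k}. even (a j + 1)" by simp
    qed
    then show ?thesis
      using True sum_Pow_prod_signs[of "{1..<k}" "\<lambda>j. a j + 1"] by simp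
  next
    case False
    have "S = k" if "\<forall>j<k. a j = 1" using that by (simp add: S_def)
    with False have not_ones: "\<not> (\<forall>j<k. a j = 1)" by blast
    show ?thesis
    proof (cases "S = k + N")
      case True
      \<comment> \<open>Otherwise \<open>a j < d j\<close> for \<open>k - 1\<close> indices, whereas total degree \<open>k + N\<close> is only
        \<open>k - 2\<close> below the maximum.\<close>
      have "\<not> (\<forall>j\<in>{1..<k}. even (a j + 1 + d j))"
      proof
        assume even: "\<forall>j\<in>{1..<k}. even (a j + 1 + d j)"
        have "a j + 1 \<le> d j" if "j \<in> {1..<k}" for j
        proof -
          have "even (a j + 1 + d j)" using even that by blast
          then have "a j \<noteq> d j" by auto
          then show ?thesis using ad[of j] that by simp
        qed
        then have "(\<Sum>j=1..<k. a j + 1) \<le> (\<Sum>j=1..<k. d j)"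
          by (rule sum_mono)
        then have "(\<Sum>j=1..<k. a j) + (k - 1) \<le> (\<Sum>j=1..<k. d j)"
          unfolding sum.distrib by simp
        moreover have "a 0 \<le> d 0" using ad[of 0] \<open>k > 0\<close> by simp
        ultimately have "S + (k - 1) \<le> (\<Sum>j<k. d j)"
          by (simp add: S_def split0)
        then show False using N True \<open>k > 0\<close> by linarith
      qed
      moreover have "(\<Prod>j\<in>E. (- 1) ^ (a j + 1)) * line_sign d E
          = (\<Prod>j\<in>E. (- 1) ^ (a j + 1 + d j))" for E
        by (simp add: line_sign_def power_add flip: prod.distrib)
      ultimately show ?thesis
        using False True not_ones sum_Pow_prod_signs[of "{1..<k}" "\<lambda>j. a j + 1 + d j"]
        by (simp del: power_Suc)
    next
      case 2: False
      then show ?thesis using False not_ones by simp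
    qed
  qed
  finally show ?thesis .
qed

text \<open>
  By linearity the formula extends from monomials to all polynomials of degree at most \<open>d j\<close> in
  the \<open>j\<close>-th variable.  Products of univariate polynomials suffice, since every entry of a
  product of powers of \<open>e\<^sub>1 + z\<^sub>j e\<^sub>2\<close> has this form.
\<close>

lemma quadrature_product:
  fixes p :: "nat \<Rightarrow> complex poly"
  assumes "k > 0"
    and N: "(\<Sum>j<k. d j) + 2 = N + 2 * k" and "N > k"
    and d: "\<And>j. j < k \<Longrightarrow> d j > 0"
    and p: "\<And>j. j < k \<Longrightarrow> degree (p j) \<le> d j"
  shows "(\<Sum>x\<in>nodes k d N. node_weight k N x * (\<Prod>j<k. poly (p j) (node_coord x j)))
           = (\<Prod>j<k. coeff (p j) 1)"
proof -
  define A where "A = PiE {..<k} (\<lambda>j. {..d j})"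
  define e where "e = (\<lambda>j\<in>{..<k}. 1 :: nat)"
  have e: "e \<in> A" "finite A"
    using d by (auto simp: A_def e_def Suc_le_eq intro!: finite_PiE)
  have "poly (p j) z = (\<Sum>i\<le>d j. coeff (p j) i * z ^ i)" if "j < k" for j z
    using poly_as_sum_of_monoms'[OF p[OF that]]
    by (metis (no_types, lifting) poly_monom poly_sum sum.cong)
  then have "(\<Prod>j<k. poly (p j) (z j))
      = (\<Sum>a\<in>A. (\<Prod>j<k. coeff (p j) (a j)) * (\<Prod>j<k. z j ^ a j))" for z
    by (simp add: A_def prod_sum_PiE flip: prod.distrib)
  then have "(\<Sum>x\<in>nodes k d N. node_weight k N x * (\<Prod>j<k. poly (p j) (node_coord x j)))
      = (\<Sum>a\<in>A. (\<Prod>j<k. coeff (p j) (a j))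
          * (\<Sum>x\<in>nodes k d N. node_weight k N x * (\<Prod>j<k. node_coord x j ^ a j)))"
    by (simp add: sum_distrib_left mult_ac sum.swap[of _ A])
  also have "\<dots> = (\<Sum>a\<in>A. if a = e then \<Prod>j<k. coeff (p j) 1 else 0)"
  proof (rule sum.cong)
    fix a assume a: "a \<in> A"
    then have "(\<forall>j<k. a j = 1) \<longleftrightarrow> a = e"
      by (auto simp: A_def e_def PiE_def extensional_def)
    moreover have "(\<Sum>x\<in>nodes k d N. node_weight k N x * (\<Prod>j<k. node_coord x j ^ a j))
        = (if \<forall>j<k. a j = 1 then 1 else 0)"
      using a assms by (intro quadrature_monomial) (auto simp: A_def PiE_iff)
    ultimately show "(\<Prod>j<k. coeff (p j) (a j))
          * (\<Sum>x\<in>nodes k d N. node_weight k N x * (\<Prod>j<k. node_coord x j ^ a j))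
        = (if a = e then \<Prod>j<k. coeff (p j) 1 else 0)"
      by (auto simp: e_def)
  qed simp
  also have "\<dots> = (\<Prod>j<k. coeff (p j) 1)" using e by simp
  finally show ?thesis .
qed

section \<open>W-states as linear coefficients of powers\<close>

text \<open>
  The entry of \<open>(e\<^sub>1 + z e\<^sub>2)\<^sup>\<otimes>\<^sup>d\<close> at the position \<open>is\<close>, as a polynomial in \<open>z\<close>.  It is zero on lists
  of the wrong length, as arrays are, so that the statements below hold at every list.
\<close>

definition entry_poly :: "complex ^ 2 \<Rightarrow> complex ^ 2 \<Rightarrow> nat \<Rightarrow> 2 list \<Rightarrow> complex poly" where
  "entry_poly e1 e2 d is =
     (if length is = d then \<Prod>j<d. [:e1 $ (is ! j), e2 $ (is ! j):] else 0)"

lemma degree_entry_poly: "degree (entry_poly e1 e2 d is) \<le> d"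
proof -
  have "degree (\<Prod>j<d. [:e1 $ (is ! j), e2 $ (is ! j):])
      \<le> (\<Sum>j<d. degree [:e1 $ (is ! j), e2 $ (is ! j):])"
    using degree_prod_sum_le[of "{..<d}" "\<lambda>j. [:e1 $ (is ! j), e2 $ (is ! j):]"]
    by (simp only: o_def finite_lessThan)
  also have "\<dots> \<le> (\<Sum>j<d. 1)" by (rule sum_mono) simp
  finally show ?thesis by (simp add: entry_poly_def)
qed

lemma elem_tensor_entry:
  "elem_tensor vs is = (if length is = length vs then \<Prod>j<length vs. (vs ! j) $ (is ! j) else 0)"
  by (simp add: elem_tensor_def tensor_prod_def)

lemma tensor_power_entry:
  "tensor_power d v is = (if length is = d then \<Prod>j<d. v $ (is ! j) else 0)"
  by (simp add: tensor_power_def elem_tensor_entry)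

lemma tensor_power_line:
  "tensor_power d (e1 + z *s e2) is = poly (entry_poly e1 e2 d is) z"
  by (simp add: tensor_power_entry entry_poly_def poly_prod)

lemma tensor_power_scale:
  "tensor_power d (c *s v) is = c ^ d * tensor_power d v is"
  by (simp add: tensor_power_entry prod.distrib)

lemma coeff_1_prod_linear:
  fixes u v :: "'a \<Rightarrow> 'b :: comm_ring_1"
  assumes "finite A"
  shows "coeff (\<Prod>j\<in>A. [:u j, v j:]) 1 = (\<Sum>i\<in>A. \<Prod>j\<in>A. if j = i then v j else u j)"
  using assms
proof (induction A rule: finite_induct)
  case (insert x A)
  have c0: "coeff (\<Prod>j\<in>A. [:u j, v j:]) 0 = (\<Prod>j\<in>A. u j)"
    by (simp flip: poly_0_coeff_0 add: poly_prod)
  have "(\<Prod>j\<in>A. if j = x then v j else u j) = (\<Prod>j\<in>A. u j)"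
    using insert.hyps by (intro prod.cong) auto
  moreover have "(\<Sum>i\<in>A. \<Prod>j\<in>insert x A. if j = i then v j else u j)
      = (\<Sum>i\<in>A. u x * (\<Prod>j\<in>A. if j = i then v j else u j))"
    using insert.hyps by (intro sum.cong) auto
  ultimately show ?case
    using insert by (simp add: c0 sum_distrib_left coeff_pCons)
qed simp

text \<open>
  \<open>W\<^sub>d\<close> is the derivative of \<open>(e\<^sub>1 + z e\<^sub>2)\<^sup>\<otimes>\<^sup>d\<close> at \<open>z = 0\<close>: the linear term collects the ways to
  take \<open>e\<^sub>2\<close> from exactly one factor.
\<close>

lemma W_state_entry: "W_state e1 e2 d is = coeff (entry_poly e1 e2 d is) 1"
proof (cases "length is = d")
  case True
  have "elem_tensor (replicate (i - 1) e1 @ [e2] @ replicate (d - i) e1) is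
      = (\<Prod>j<d. if j = i - 1 then e2 $ (is ! j) else e1 $ (is ! j))" if "i \<in> {1..d}" for i
  proof -
    have len: "length (replicate (i - 1) e1 @ [e2] @ replicate (d - i) e1) = d"
      using that by auto
    have "(replicate (i - 1) e1 @ [e2] @ replicate (d - i) e1) ! j
        = (if j = i - 1 then e2 else e1)" if "j < d" for j
      using that \<open>i \<in> {1..d}\<close> by (auto simp: nth_append nth_Cons split: nat.splits)
    then show ?thesis
      using True unfolding elem_tensor_entry len
      by (auto intro!: prod.cong)
  qed
  then have "W_state e1 e2 d is
      = (\<Sum>i=1..d. \<Prod>j<d. if j = i - 1 then e2 $ (is ! j) else e1 $ (is ! j))"
    unfolding W_state_def by (intro sum.cong) auto
  also have "\<dots> = (\<Sum>i<d. \<Prod>j<d. if j = i then e2 $ (is ! j) else e1 $ (is ! j))"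
    by (rule sum.reindex_bij_witness[of _ Suc "\<lambda>i. i - 1"]) auto
  finally show ?thesis
    using True by (simp add: entry_poly_def coeff_1_prod_linear[simplified])
next
  case False
  have "elem_tensor (replicate (i - 1) e1 @ [e2] @ replicate (d - i) e1) is = 0"
    if "i \<in> {1..d}" for i
    using that False by (auto simp: elem_tensor_entry)
  then show ?thesis using False by (simp add: W_state_def entry_poly_def)
qed

section \<open>From quadrature to rank\<close>

text \<open>
  Over the complex numbers, a weight can be absorbed into the first factor of each term by
  scaling its vector with a root of the weight of order \<open>ds ! 0\<close>.
\<close>

lemma has_ps_decomp_weighted:
  fixes c :: "'a \<Rightarrow> complex" and v :: "'a \<Rightarrow> nat \<Rightarrow> complex ^ 2"
  assumes "finite I" "ds \<noteq> []" "ds ! 0 > 0"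
    and T: "\<And>idx. T idx = (\<Sum>x\<in>I. c x * tensor_prod
               (map (\<lambda>j. tensor_power (ds ! j) (v x j)) [0..<length ds]) idx)"
  shows "has_ps_decomp ds T (card I)"
proof -
  obtain h where h: "bij_betw h {..<card I} I"
    using ex_bij_betw_nat_finite[OF \<open>finite I\<close>] by (auto simp: lessThan_atLeast0)
  have "\<exists>z. z ^ (ds ! 0) = c x" for x
  proof (cases "c x = 0")
    case True
    then show ?thesis using \<open>ds ! 0 > 0\<close> by (intro exI[of _ 0]) simp
  next
    case False
    then have "card {z. z ^ (ds ! 0) = c x} > 0"
      using \<open>ds ! 0 > 0\<close> by (simp add: card_nth_roots)
    then show ?thesis by (metis (mono_tags, lifting) card_gt_0_iff empty_Collect_eq)
  qed
  then obtain g where g: "\<And>x. g x ^ (ds ! 0) = c x" by metis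
  define w where "w x j = (if j = 0 then g x *s v x j else v x j)" for x j
  have "tensor_prod (map (\<lambda>j. tensor_power (ds ! j) (w x j)) [0..<length ds]) idx
      = c x * tensor_prod (map (\<lambda>j. tensor_power (ds ! j) (v x j)) [0..<length ds]) idx"
    for x idx
  proof -
    have "tensor_power (ds ! j) (w x j) is
        = (if j = 0 then c x else 1) * tensor_power (ds ! j) (v x j) is" for j "is"
      by (simp add: w_def tensor_power_scale g)
    moreover have "(\<Prod>j<length ds. if j = 0 then c x else 1) = c x"
      using \<open>ds \<noteq> []\<close> by (subst prod.delta) auto
    ultimately show ?thesis
      by (simp add: tensor_prod_def prod.distrib)
  qed
  then have "T idx = (\<Sum>i<card I. tensor_prod
      (map (\<lambda>j. tensor_power (ds ! j) (w (h i) j)) [0..<length ds]) idx)" for idx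
    unfolding T by (subst sum.reindex_bij_betw[OF h, symmetric]) simp
  then show ?thesis
    unfolding has_ps_decomp_def by (intro exI[of _ "\<lambda>i. w (h i)"]) auto
qed

theorem theorem1p1:
  fixes e1 e2 :: "complex ^ 2" and k :: nat and ds :: "nat list"
  assumes "is_basis2 e1 e2"
    and "k \<ge> 2"
    and "length ds = k"
    and "\<forall>d \<in> set ds. d \<ge> 3"
  shows "ps_rank ds (tensor_prod (map (W_state e1 e2) ds))
           \<le> enat (2 ^ (k - 1) * (sum_list ds - 2 * k + 2))"
proof -
  define N where "N = sum_list ds - 2 * k + 2"
  have d3: "ds ! j \<ge> 3" if "j < k" for j
    using that assms by simp
  have sum: "sum_list ds = (\<Sum>j<k. ds ! j)"
    using assms(3) by (simp add: sum_list_sum_nth lessThan_atLeast0)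
  have "3 * k \<le> (\<Sum>j<k. ds ! j)"
    using sum_mono[of "{..<k}" "\<lambda>_. 3" "\<lambda>j. ds ! j"] d3 by simp
  then have N: "(\<Sum>j<k. ds ! j) + 2 = N + 2 * k" "N > k"
    by (auto simp: N_def sum)
  have "tensor_prod (map (W_state e1 e2) ds) idx
      = (\<Sum>x\<in>nodes k ((!) ds) N. node_weight k N x * tensor_prod
          (map (\<lambda>j. tensor_power (ds ! j) (e1 + node_coord x j *s e2)) [0..<length ds]) idx)"
    for idx
  proof (cases "length idx = k")
    case True
    define p where "p j = entry_poly e1 e2 (ds ! j) (idx ! j)" for j
    have "(\<Sum>x\<in>nodes k ((!) ds) N. node_weight k N x * (\<Prod>j<k. poly (p j) (node_coord x j)))
           = (\<Prod>j<k. coeff (p j) 1)"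
      using assms d3 N by (intro quadrature_product) (fastforce simp: p_def degree_entry_poly)+
    then show ?thesis
      using True assms(3)
      by (simp add: tensor_prod_def W_state_entry tensor_power_line p_def)
  next
    case False
    then show ?thesis using assms(3) by (simp add: tensor_prod_def)
  qed
  moreover have "ds \<noteq> []" "ds ! 0 > 0" "finite (nodes k ((!) ds) N)"
    using assms(2,3) d3[of 0] N finite_nodes[of N] by force+
  ultimately have "has_ps_decomp ds (tensor_prod (map (W_state e1 e2) ds))
      (card (nodes k ((!) ds) N))"
    by (intro has_ps_decomp_weighted)
  then have "has_ps_decomp ds (tensor_prod (map (W_state e1 e2) ds)) (2 ^ (k - 1) * N)"
    using N by (simp add: card_nodes)
  then show ?thesis
    unfolding ps_rank_def N_def by (intro INF_lower) simp
qed

end
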